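(* Let $M$ be an ordered $\Gamma$-groupoid and let $\mu,\sigma$ be fuzzy ideals of $M$. Then $\mu\times\sigma$ is a fuzzy ideal of $M\times M$.
   Context: Let $M,\Gamma$ be nonempty sets. $M$ is a $\Gamma$-groupoid if there is a well-defined operation $M\times\Gamma\times M\to M$, $(a,\gamma,b)\mapsto a\gamma b$ (no associativity assumed). An ordered $\Gamma$-groupoid is a $\Gamma$-groupoid $M$ with a partial order $\le$ on $M$ such that $a\le b$ implies $a\gamma c\le b\gamma c$ and $c\gamma a\le c\gamma b$ for all $c\in M$, $\gamma\in\Gamma$. $M\times M$ is an ordered $\Gamma$-groupoid under $(a,b)\gamma(c,d):=(a\gamma c,b\gamma d)$ and the componentwise order: $(a,b)\le(c,d)$ iff $a\le c$ and $b\le d$. A fuzzy subset of an ordered $\Gamma$-groupoid $N$ is any mapping $\mu:N\to[0,1]$. It is a fuzzy left (resp. right) ideal of $N$ if (1) $\mu(x\gamma y)\ge\mu(y)$ (resp. $\mu(x\gamma y)\ge\mu(x)$) for all $x,y\in N$, $\gamma\in\Gamma$, and (2) $x\le y$ implies $\mu(x)\ge\mu(y)$. It is a fuzzy ideal if it is both a fuzzy left and a fuzzy right ideal. For fuzzy subsets $\mu,\sigma$ of $M$, $\mu\times\sigma$ is the fuzzy subset of $M\times M$ given by $(\mu\times\sigma)(x,y):=\min\{\mu(x),\sigma(y)\}$. *)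

theory Defs
  imports Complex_Main "HOL-Library.FuncSet"
begin

locale gamma_groupoid =
  fixes M :: "'a set" and \<Gamma> :: "'g set" and opr :: "'a \<Rightarrow> 'g \<Rightarrow> 'a \<Rightarrow> 'a"
  assumes carrier_nonempty: "M \<noteq> {}"
    and Gamma_nonempty: "\<Gamma> \<noteq> {}"
    and opr_closed: "\<lbrakk>a \<in> M; \<gamma> \<in> \<Gamma>; b \<in> M\<rbrakk> \<Longrightarrow> opr a \<gamma> b \<in> M"

text \<open>The order is a relation on the carrier: \<open>(a, b) \<in> le\<close> means that \<open>a\<close> is below \<open>b\<close>.\<close>

locale ordered_gamma_groupoid = gamma_groupoid M \<Gamma> opr
  for M :: "'a set" and \<Gamma> :: "'g set" and opr :: "'a \<Rightarrow> 'g \<Rightarrow> 'a \<Rightarrow> 'a" +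
  fixes le :: "('a \<times> 'a) set"
  assumes partial_order: "partial_order_on M le"
    and opr_mono_left:
      "\<lbrakk>(a, b) \<in> le; c \<in> M; \<gamma> \<in> \<Gamma>\<rbrakk> \<Longrightarrow> (opr a \<gamma> c, opr b \<gamma> c) \<in> le"
    and opr_mono_right:
      "\<lbrakk>(a, b) \<in> le; c \<in> M; \<gamma> \<in> \<Gamma>\<rbrakk> \<Longrightarrow> (opr c \<gamma> a, opr c \<gamma> b) \<in> le"

definition prod_opr :: "('a \<Rightarrow> 'g \<Rightarrow> 'a \<Rightarrow> 'a) \<Rightarrow> 'a \<times> 'a \<Rightarrow> 'g \<Rightarrow> 'a \<times> 'a \<Rightarrow> 'a \<times> 'a" where
  "prod_opr opr p \<gamma> q = (opr (fst p) \<gamma> (fst q), opr (snd p) \<gamma> (snd q))"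

definition prod_le :: "('a \<times> 'a) set \<Rightarrow> (('a \<times> 'a) \<times> ('a \<times> 'a)) set" where
  "prod_le le = {((a, b), (c, d)). (a, c) \<in> le \<and> (b, d) \<in> le}"

text \<open>Fuzzy subsets are total functions of which only the values on the carrier matter.\<close>

definition fuzzy_subset :: "'a set \<Rightarrow> ('a \<Rightarrow> real) \<Rightarrow> bool" where
  "fuzzy_subset N \<mu> \<longleftrightarrow> \<mu> \<in> N \<rightarrow> {0..1}"

definition fuzzy_left_ideal ::
  "'a set \<Rightarrow> 'g set \<Rightarrow> ('a \<Rightarrow> 'g \<Rightarrow> 'a \<Rightarrow> 'a) \<Rightarrow> ('a \<times> 'a) set \<Rightarrow> ('a \<Rightarrow> real) \<Rightarrow> bool" where
  "fuzzy_left_ideal N \<Gamma> opr le \<mu> \<longleftrightarrow>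
     fuzzy_subset N \<mu> \<and>
     (\<forall>x\<in>N. \<forall>y\<in>N. \<forall>\<gamma>\<in>\<Gamma>. \<mu> (opr x \<gamma> y) \<ge> \<mu> y) \<and>
     (\<forall>x\<in>N. \<forall>y\<in>N. (x, y) \<in> le \<longrightarrow> \<mu> x \<ge> \<mu> y)"

definition fuzzy_right_ideal ::
  "'a set \<Rightarrow> 'g set \<Rightarrow> ('a \<Rightarrow> 'g \<Rightarrow> 'a \<Rightarrow> 'a) \<Rightarrow> ('a \<times> 'a) set \<Rightarrow> ('a \<Rightarrow> real) \<Rightarrow> bool" where
  "fuzzy_right_ideal N \<Gamma> opr le \<mu> \<longleftrightarrow>
     fuzzy_subset N \<mu> \<and>
     (\<forall>x\<in>N. \<forall>y\<in>N. \<forall>\<gamma>\<in>\<Gamma>. \<mu> (opr x \<gamma> y) \<ge> \<mu> x) \<and>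
     (\<forall>x\<in>N. \<forall>y\<in>N. (x, y) \<in> le \<longrightarrow> \<mu> x \<ge> \<mu> y)"

definition fuzzy_ideal ::
  "'a set \<Rightarrow> 'g set \<Rightarrow> ('a \<Rightarrow> 'g \<Rightarrow> 'a \<Rightarrow> 'a) \<Rightarrow> ('a \<times> 'a) set \<Rightarrow> ('a \<Rightarrow> real) \<Rightarrow> bool" where
  "fuzzy_ideal N \<Gamma> opr le \<mu> \<longleftrightarrow>
     fuzzy_left_ideal N \<Gamma> opr le \<mu> \<and> fuzzy_right_ideal N \<Gamma> opr le \<mu>"

definition fuzzy_times :: "('a \<Rightarrow> real) \<Rightarrow> ('a \<Rightarrow> real) \<Rightarrow> 'a \<times> 'a \<Rightarrow> real" where
  "fuzzy_times \<mu> \<sigma> = (\<lambda>(x, y). min (\<mu> x) (\<sigma> y))"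

lemma ordered_gamma_groupoid_prod:
  assumes "ordered_gamma_groupoid M \<Gamma> opr le"
  shows "ordered_gamma_groupoid (M \<times> M) \<Gamma> (prod_opr opr) (prod_le le)"
proof -
  interpret ordered_gamma_groupoid M \<Gamma> opr le by (rule assms)
  have r: "refl_on M le" "trans le" "antisym le" "le \<subseteq> M \<times> M"
    using partial_order by (auto simp: partial_order_on_def preorder_on_def)
  have "refl_on (M \<times> M) (prod_le le)"
    using r(1) by (auto simp: refl_on_def prod_le_def)
  moreover have "trans (prod_le le)"
    using r(2) unfolding trans_def prod_le_def by blast
  moreover have "antisym (prod_le le)"
    using r(3) unfolding antisym_def prod_le_def by blast
  moreover have "prod_le le \<subseteq> (M \<times> M) \<times> (M \<times> M)"
    using r(4) unfolding prod_le_def by blast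
  ultimately have "partial_order_on (M \<times> M) (prod_le le)"
    by (simp add: partial_order_on_def preorder_on_def)
  then show ?thesis
    by unfold_locales
      (use carrier_nonempty Gamma_nonempty opr_closed opr_mono_left opr_mono_right in
        \<open>auto simp: prod_opr_def prod_le_def\<close>)
qed

end

theory Submission
  imports Defs
begin

text \<open>Operation and order on \<open>M \<times> M\<close> are componentwise, so each ideal
  inequality for \<open>fuzzy_times \<mu> \<sigma>\<close> compares two minima whose entries are
  already compared by the same inequality for \<open>\<mu>\<close> and for \<open>\<sigma>\<close>.
  Since \<open>min\<close> is monotone in both arguments, the inequality carries over.\<close>

lemma fuzzy_subset_times:
  assumes "fuzzy_subset M \<mu>" and "fuzzy_subset M \<sigma>"
  shows "fuzzy_subset (M \<times> M) (fuzzy_times \<mu> \<sigma>)"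
  \<comment> \<open>The minimum is one of the two values, and each lies in [0,1].\<close>
  using assms by (fastforce simp: fuzzy_subset_def fuzzy_times_def Pi_iff min_def)

lemma fuzzy_left_ideal_times:
  assumes "fuzzy_left_ideal M \<Gamma> opr le \<mu>" and "fuzzy_left_ideal M \<Gamma> opr le \<sigma>"
  shows "fuzzy_left_ideal (M \<times> M) \<Gamma> (prod_opr opr) (prod_le le) (fuzzy_times \<mu> \<sigma>)"
  using assms fuzzy_subset_times[of M \<mu> \<sigma>]
  \<comment> \<open>As a simp rule \<open>min.bounded_iff\<close> would split
    \<open>a \<le> min b c\<close> into two bounds, destroying the shape
    \<open>min a b \<le> min c d\<close> that \<open>min.mono\<close> matches.\<close>
  by (auto simp: fuzzy_left_ideal_def fuzzy_times_def prod_opr_def prod_le_def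
      simp del: min.bounded_iff intro!: min.mono)

text \<open>Mirror image of the left case: the lower bound now comes from the left factor of each
  product.\<close>

lemma fuzzy_right_ideal_times:
  assumes "fuzzy_right_ideal M \<Gamma> opr le \<mu>" and "fuzzy_right_ideal M \<Gamma> opr le \<sigma>"
  shows "fuzzy_right_ideal (M \<times> M) \<Gamma> (prod_opr opr) (prod_le le) (fuzzy_times \<mu> \<sigma>)"
  using assms fuzzy_subset_times[of M \<mu> \<sigma>]
  by (auto simp: fuzzy_right_ideal_def fuzzy_times_def prod_opr_def prod_le_def
      simp del: min.bounded_iff intro!: min.mono)

theorem theorem12:
  fixes M :: "'a set" and \<Gamma> :: "'g set"
    and opr :: "'a \<Rightarrow> 'g \<Rightarrow> 'a \<Rightarrow> 'a" and le :: "('a \<times> 'a) set"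
    and \<mu> \<sigma> :: "'a \<Rightarrow> real"
  assumes "ordered_gamma_groupoid M \<Gamma> opr le"
    and "fuzzy_ideal M \<Gamma> opr le \<mu>"
    and "fuzzy_ideal M \<Gamma> opr le \<sigma>"
  shows "fuzzy_ideal (M \<times> M) \<Gamma> (prod_opr opr) (prod_le le) (fuzzy_times \<mu> \<sigma>)"
  using assms(2,3)
  by (simp add: fuzzy_ideal_def fuzzy_left_ideal_times fuzzy_right_ideal_times)

end
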